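(* Let $0\le\varrho\le 1$ and $0\le u\le 1/2$. Then \begin{align*} \text{(L)}\quad & C(u,u;\varrho)\ \ge\ u\cdot g(u;\varrho),\\ \text{(U)}\quad & C(u,u;\varrho)\ \le\ 2u\cdot g(u;\varrho). \end{align*} The lower bound (L) is tight (i.e. holds with equality) for $\varrho=0$ or $u=0$. The maximum over $\varrho\in[0,1]$, $u\in[0,1/2]$ of the error $C(u,u;\varrho)-u\,g(u;\varrho)$ of (L) equals $1/4$ and is attained for $u=1/2$, $\varrho=1$. The upper bound (U) is tight (i.e. holds with equality) for $\varrho=1$ or $u=0$. The maximum over $\varrho\in[0,1]$, $u\in[0,1/2]$ of the error $2u\,g(u;\varrho)-C(u,u;\varrho)$ of (U) equals $1/4$ and is attained for $u=1/2$, $\varrho=0$.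
   Context: $\Phi$ is the standard normal distribution function. For $\varrho\in(-1,1)$, $$\varphi_2(x,y;\varrho)=\frac{1}{2\pi\sqrt{1-\varrho^2}}\exp\left(-\frac{x^2-2\varrho xy+y^2}{2(1-\varrho^2)}\right),\qquad \Phi_2(h,k;\varrho)=\int_{-\infty}^h\int_{-\infty}^k\varphi_2(x,y;\varrho)\,dy\,dx,$$ and the bivariate normal copula is $C(u,v;\varrho)=\Phi_2(\Phi^{-1}(u),\Phi^{-1}(v);\varrho)$ for $u,v\in(0,1)$, extended continuously to $[0,1]^2$ (so $C(0,v;\varrho)=C(u,0;\varrho)=0$). For $\varrho=1$ it is defined by the limit $\varrho\to1$: $C(u,v;1)=\min(u,v)$. For $\varrho\in(-1,1]$ and $u\in(0,1)$, $$g(u;\varrho):=\Phi\left(\sqrt{\frac{1-\varrho}{1+\varrho}}\cdot\Phi^{-1}(u)\right).$$ At $u=0$, $g(0;\varrho)$ is the limit $u\to0^+$ of $g(u;\varrho)$ (it equals $0$ for $\varrho<1$); in any case $u\cdot g(u;\varrho)$ is $0$ at $u=0$. *)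

theory Defs
  imports "HOL-Probability.Probability"
begin

definition std_normal_cdf :: "real \<Rightarrow> real" where
  "std_normal_cdf = cdf std_normal_distribution"

text \<open>Meaningful on the open unit interval, the range of the injective function
  \<^const>\<open>std_normal_cdf\<close>.\<close>

definition std_normal_quantile :: "real \<Rightarrow> real" where
  "std_normal_quantile = inv std_normal_cdf"

definition bvn_density :: "real \<Rightarrow> real \<Rightarrow> real \<Rightarrow> real" where
  "bvn_density \<rho> x y =
     1 / (2 * pi * sqrt (1 - \<rho>\<^sup>2)) *
     exp (- ((x\<^sup>2 - 2 * \<rho> * x * y + y\<^sup>2) / (2 * (1 - \<rho>\<^sup>2))))"

definition bvn_cdf :: "real \<Rightarrow> real \<Rightarrow> real \<Rightarrow> real" where
  "bvn_cdf \<rho> h k = (LBINT x:{..h}. (LBINT y:{..k}. bvn_density \<rho> x y))"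

definition bvn_copula_interior :: "real \<Rightarrow> real \<Rightarrow> real \<Rightarrow> real" where
  "bvn_copula_interior \<rho> u v =
     bvn_cdf \<rho> (std_normal_quantile u) (std_normal_quantile v)"

text \<open>Continuous extension from the open to the closed unit square, for
  $-1 < \rho < 1$.\<close>

definition bvn_copula_nondegenerate :: "real \<Rightarrow> real \<Rightarrow> real \<Rightarrow> real" where
  "bvn_copula_nondegenerate \<rho> u v =
     (if u \<in> {0<..<1} \<and> v \<in> {0<..<1} then bvn_copula_interior \<rho> u v
      else Lim (at (u, v) within {0<..<1} \<times> {0<..<1})
             (\<lambda>(x, y). bvn_copula_interior \<rho> x y))"

text \<open>The case $\rho = 1$ is the limit from the left, whose value is
  $\min(u,v)$.\<close>

definition bvn_copula :: "real \<Rightarrow> real \<Rightarrow> real \<Rightarrow> real" where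
  "bvn_copula \<rho> u v =
     (if \<rho> = 1 then Lim (at_left 1) (\<lambda>r. bvn_copula_nondegenerate r u v)
      else bvn_copula_nondegenerate \<rho> u v)"

definition bvn_g_interior :: "real \<Rightarrow> real \<Rightarrow> real" where
  "bvn_g_interior \<rho> u =
     std_normal_cdf (sqrt ((1 - \<rho>) / (1 + \<rho>)) * std_normal_quantile u)"

text \<open>The value at $u = 0$ is the right limit: $0$ for $\rho < 1$, and $1/2$ for
  $\rho = 1$.\<close>

definition bvn_g :: "real \<Rightarrow> real \<Rightarrow> real" where
  "bvn_g \<rho> u = (if u = 0 then Lim (at_right 0) (bvn_g_interior \<rho>) else bvn_g_interior \<rho> u)"

end

theory Submission
  imports Defs
begin

text \<open>
  Put $a = \sqrt{(1-\rho)/(1+\rho)}$ and $h = \Phi^{-1}(u) \le 0$. Splitting the square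
  $\{x, y \le h\}$ along its diagonal, the symmetry of the bivariate density gives
  $C(u,u;\rho) = 2 \int_{-\infty}^h \varphi(x)\,\Phi(a x)\,dx$, so (U) is monotonicity of $\Phi$.
  Splitting $\Phi(h)\,\Phi(a h) = \int\!\int_{x, y \le h} a\,\varphi(x)\,\varphi(a y)\,dy\,dx$ in the same
  way, (L) reduces to the pointwise inequality
  $\varphi(y)\,\varphi(a x) \le \varphi(x)\,\varphi(a y)$ for $y \le x \le 0$ and $a \le 1$.
  The case $\rho = 1$ is the limit $a \to 0$. Both error bounds follow from (L), (U) and
  $u\,g(u;\rho) \le 1/2 \cdot 1/2$.
\<close>

section \<open>Folding an integral over a square along the diagonal\<close>

text \<open>Tonelli lets the triangle above the diagonal be reflected onto the one below, and the
  diagonal itself is a null set.\<close>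

lemma nn_integral_symmetrize_lborel:
  fixes f :: "real \<Rightarrow> real \<Rightarrow> ennreal"
  assumes f: "case_prod f \<in> borel_measurable (lborel \<Otimes>\<^sub>M lborel)"
  shows "(\<integral>\<^sup>+x\<in>{..h}. (\<integral>\<^sup>+y\<in>{..h}. f x y \<partial>lborel) \<partial>lborel) =
    (\<integral>\<^sup>+x\<in>{..h}. (\<integral>\<^sup>+y\<in>{..x}. (f x y + f y x) \<partial>lborel) \<partial>lborel)"
proof -
  have [measurable]: "case_prod f \<in> borel_measurable (borel \<Otimes>\<^sub>M borel)"
    using f by (simp cong: measurable_cong_sets)
  have [measurable]: "(\<lambda>z. f (snd z) (fst z)) \<in> borel_measurable (borel \<Otimes>\<^sub>M borel)"
    by measurable
  \<comment> \<open>\<open>g\<close> and \<open>l\<close> restrict \<open>f\<close> to the open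
    triangles below and above the diagonal, and \<open>g'\<close> is the reflection of
    \<open>l\<close>: \<open>g' x y = l y x\<close>.\<close>
  define g where "g = (\<lambda>x y. f x y * indicator {y. y < x \<and> x \<le> h} y)"
  define l where "l = (\<lambda>x y. f x y * indicator {y. x < y \<and> y \<le> h} y)"
  define g' where "g' = (\<lambda>x y. f y x * indicator {y. y < x \<and> x \<le> h} y)"
  have mg: "case_prod g \<in> borel_measurable (borel \<Otimes>\<^sub>M borel)"
    and ml: "case_prod l \<in> borel_measurable (borel \<Otimes>\<^sub>M borel)"
    and mg': "case_prod g' \<in> borel_measurable (borel \<Otimes>\<^sub>M borel)"
    unfolding g_def l_def g'_def by measurable
  note [measurable] = mg ml mg'
  have "(\<integral>\<^sup>+x\<in>{..h}. (\<integral>\<^sup>+y\<in>{..h}. f x y \<partial>lborel) \<partial>lborel) =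
      (\<integral>\<^sup>+x. (\<integral>\<^sup>+y. g x y + l x y \<partial>lborel) \<partial>lborel)"
  proof (rule nn_integral_cong)
    fix x
    have "(\<integral>\<^sup>+y\<in>{..h}. f x y \<partial>lborel) * indicator {..h} x =
        (\<integral>\<^sup>+y. f x y * indicator {..h} y * indicator {..h} x \<partial>lborel)"
      by (rule nn_integral_multc[symmetric]) measurable
    also have "\<dots> = (\<integral>\<^sup>+y. g x y + l x y \<partial>lborel)"
    proof (rule nn_integral_cong_AE)
      \<comment> \<open>The two sides can differ only at \<open>y = x\<close>, a single point of the
        slice.\<close>
      show "AE y in lborel. f x y * indicator {..h} y * indicator {..h} x = g x y + l x y"
        using AE_lborel_singleton[of x]
        by eventually_elim (auto simp: g_def l_def indicator_def)
    qed
    finally show "(\<integral>\<^sup>+y\<in>{..h}. f x y \<partial>lborel) * indicator {..h} x = (\<integral>\<^sup>+y. g x y + l x y \<partial>lborel)" .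
  qed
  also have "\<dots> = (\<integral>\<^sup>+x. (\<integral>\<^sup>+y. g x y \<partial>lborel) \<partial>lborel) + (\<integral>\<^sup>+x. (\<integral>\<^sup>+y. l x y \<partial>lborel) \<partial>lborel)"
    by (simp add: nn_integral_add)
  also have "(\<integral>\<^sup>+x. (\<integral>\<^sup>+y. l x y \<partial>lborel) \<partial>lborel) = (\<integral>\<^sup>+y. (\<integral>\<^sup>+x. l x y \<partial>lborel) \<partial>lborel)"
    by (rule lborel_pair.Fubini'[symmetric]) (simp cong: measurable_cong_sets)
  also have "\<dots> = (\<integral>\<^sup>+y. (\<integral>\<^sup>+x. g' y x \<partial>lborel) \<partial>lborel)"
    by (intro nn_integral_cong) (auto simp: l_def g'_def indicator_def)
  also have "(\<integral>\<^sup>+x. (\<integral>\<^sup>+y. g x y \<partial>lborel) \<partial>lborel) + \<dots> =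
      (\<integral>\<^sup>+x. (\<integral>\<^sup>+y. g x y + g' x y \<partial>lborel) \<partial>lborel)"
    by (simp add: nn_integral_add)
  also have "\<dots> = (\<integral>\<^sup>+x\<in>{..h}. (\<integral>\<^sup>+y\<in>{..x}. (f x y + f y x) \<partial>lborel) \<partial>lborel)"
  proof (rule nn_integral_cong)
    fix x
    have "(\<integral>\<^sup>+y. g x y + g' x y \<partial>lborel) =
        (\<integral>\<^sup>+y. (f x y + f y x) * indicator {..x} y * indicator {..h} x \<partial>lborel)"
    proof (rule nn_integral_cong_AE)
      show "AE y in lborel. g x y + g' x y = (f x y + f y x) * indicator {..x} y * indicator {..h} x"
        using AE_lborel_singleton[of x]
        by eventually_elim (auto simp: g_def g'_def indicator_def)
    qed
    also have "\<dots> = (\<integral>\<^sup>+y\<in>{..x}. (f x y + f y x) \<partial>lborel) * indicator {..h} x"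
      by (rule nn_integral_multc) measurable
    finally show "(\<integral>\<^sup>+y. g x y + g' x y \<partial>lborel) =
        (\<integral>\<^sup>+y\<in>{..x}. (f x y + f y x) \<partial>lborel) * indicator {..h} x" .
  qed
  finally show ?thesis .
qed

section \<open>The standard normal distribution function and its quantile\<close>

interpretation std_normal: real_distribution std_normal_distribution
  by (rule real_dist_normal_dist)

lemma ennreal_std_normal_cdf:
  "ennreal (std_normal_cdf x) = (\<integral>\<^sup>+y\<in>{..x}. ennreal (std_normal_density y) \<partial>lborel)"
  unfolding std_normal_cdf_def cdf_def
  by (subst std_normal.emeasure_eq_measure[symmetric]) (simp add: emeasure_density)

text \<open>The substitution \<open>m + s * y\<close> standardizes the variable.\<close>

lemma nn_integral_normal_density_atMost:
  assumes "0 < s"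
  shows "(\<integral>\<^sup>+y\<in>{..k}. ennreal (normal_density m s y) \<partial>lborel) = ennreal (std_normal_cdf ((k - m) / s))"
proof -
  have "(\<integral>\<^sup>+y\<in>{..k}. ennreal (normal_density m s y) \<partial>lborel) =
      ennreal \<bar>s\<bar> * (\<integral>\<^sup>+y. ennreal (normal_density m s (m + s * y)) * indicator {..k} (m + s * y) \<partial>lborel)"
    using assms by (intro nn_integral_real_affine) auto
  also have "\<dots> = (\<integral>\<^sup>+y. ennreal \<bar>s\<bar> * (ennreal (normal_density m s (m + s * y)) * indicator {..k} (m + s * y)) \<partial>lborel)"
    by (rule nn_integral_cmult[symmetric]) measurable
  also have "\<dots> = (\<integral>\<^sup>+y\<in>{..(k - m) / s}. ennreal (std_normal_density y) \<partial>lborel)"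
  proof (rule nn_integral_cong)
    fix y
    have "\<bar>s\<bar> * normal_density m s (m + s * y) = std_normal_density y"
      using assms by (simp add: normal_density_def real_sqrt_mult power_mult_distrib)
    moreover have "indicator {..k} (m + s * y) = (indicator {..(k - m) / s} y :: ennreal)"
      using assms by (auto simp: indicator_def field_simps)
    ultimately show "ennreal \<bar>s\<bar> * (ennreal (normal_density m s (m + s * y)) * indicator {..k} (m + s * y)) =
        ennreal (std_normal_density y) * indicator {..(k - m) / s} y"
      by (metis ennreal_mult' abs_ge_zero mult.assoc)
  qed
  finally show ?thesis by (simp add: ennreal_std_normal_cdf)
qed

lemma std_normal_cdf_nonneg [simp]: "0 \<le> std_normal_cdf x"
  and std_normal_cdf_le_1 [simp]: "std_normal_cdf x \<le> 1"
  and std_normal_cdf_mono: "x \<le> y \<Longrightarrow> std_normal_cdf x \<le> std_normal_cdf y"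
  unfolding std_normal_cdf_def
  by (auto intro: std_normal.cdf_nonneg std_normal.cdf_bounded_prob std_normal.cdf_nondecreasing)

lemma std_normal_cdf_measurable [measurable]: "std_normal_cdf \<in> borel_measurable borel"
  by (rule borel_measurable_mono) (auto simp: mono_def std_normal_cdf_mono)

text \<open>A distribution with a density has no atoms.\<close>

lemma std_normal_cdf_isCont: "isCont std_normal_cdf x"
proof -
  have "emeasure std_normal_distribution {x} = 0"
    by (subst emeasure_density)
       (auto intro!: nn_integral_zero' eventually_mono[OF AE_lborel_singleton[of x]])
  then show ?thesis
    by (simp add: std_normal_cdf_def std_normal.isCont_cdf measure_def)
qed

text \<open>The density is positive everywhere, so an interval that is null for the normal law would
  be Lebesgue null as well.\<close>

lemma std_normal_cdf_strict_mono:
  assumes "x < y"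
  shows "std_normal_cdf x < std_normal_cdf y"
proof -
  have "emeasure std_normal_distribution {x<..y} \<noteq> 0"
  proof
    assume "emeasure std_normal_distribution {x<..y} = 0"
    then have "AE t in lborel. t \<notin> {x<..y}"
      by (subst (asm) emeasure_density, simp, simp, subst (asm) nn_integral_0_iff_AE)
         (auto simp: indicator_def normal_density_pos less_imp_neq[symmetric] elim!: eventually_mono split: if_splits)
    then have "emeasure lborel {x<..y} = 0"
      by (subst (asm) AE_iff_measurable[where N = "{x<..y}"]) auto
    then show False using assms by simp
  qed
  then have "0 < measure std_normal_distribution {x<..y}"
    by (simp add: std_normal.emeasure_eq_measure zero_less_measure_iff)
  then show ?thesis
    using std_normal.cdf_diff_eq[OF assms] by (simp add: std_normal_cdf_def)
qed

text \<open>Reflection at the origin exchanges the two half-lines, so the value equals one minus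
  itself.\<close>

lemma std_normal_cdf_0: "std_normal_cdf 0 = 1 / 2"
proof -
  have "ennreal (std_normal_cdf 0) = (\<integral>\<^sup>+y. ennreal (std_normal_density (0 + (-1) * y)) * indicator {..0} (0 + (-1) * y) \<partial>lborel)"
    unfolding ennreal_std_normal_cdf by (subst nn_integral_real_affine[where c = "-1" and t = 0]) auto
  also have "\<dots> = (\<integral>\<^sup>+y. ennreal (std_normal_density y) * indicator {0<..} y \<partial>lborel)"
    \<comment> \<open>The reflected half-line is closed at 0; removing that null point gives the
      complement of \<open>{..0}\<close>.\<close>
    by (intro nn_integral_cong_AE eventually_mono[OF AE_lborel_singleton[of 0]])
       (auto simp: normal_density_def indicator_def)
  also have "\<dots> = emeasure std_normal_distribution {0<..}"
    by (simp add: emeasure_density)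
  also have "\<dots> = ennreal (measure std_normal_distribution {0<..})"
    by (rule std_normal.emeasure_eq_measure)
  also have "{0<..} = space std_normal_distribution - {..0::real}"
    by auto
  also have "measure std_normal_distribution \<dots> = 1 - std_normal_cdf 0"
    by (subst std_normal.prob_compl) (auto simp: std_normal_cdf_def cdf_def)
  finally show ?thesis by simp
qed

text \<open>As \<open>inv\<close> is a right inverse on the range only, it suffices that
  \<open>u\<close> is attained; the limits at both infinities and the intermediate value theorem
  give this.\<close>

lemma std_normal_cdf_quantile:
  assumes "0 < u" "u < 1"
  shows "std_normal_cdf (std_normal_quantile u) = u"
proof -
  have "\<forall>\<^sub>F x in at_bot. std_normal_cdf x < u"
    using std_normal.cdf_lim_at_bot assms unfolding std_normal_cdf_def by (intro order_tendstoD) auto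
  then obtain a where a: "\<And>x. x \<le> a \<Longrightarrow> std_normal_cdf x < u"
    by (auto simp: eventually_at_bot_linorder)
  have "\<forall>\<^sub>F x in at_top. u < std_normal_cdf x"
    using std_normal.cdf_lim_at_top_prob assms unfolding std_normal_cdf_def by (intro order_tendstoD) auto
  then obtain b where b: "\<And>x. x \<ge> b \<Longrightarrow> u < std_normal_cdf x"
    by (auto simp: eventually_at_top_linorder)
  \<comment> \<open>\<open>min\<close> and \<open>max\<close> provide an ordered interval without
    first comparing \<open>a\<close> and \<open>b\<close>.\<close>
  have "\<exists>x\<ge>min a b. x \<le> max a b \<and> std_normal_cdf x = u"
    using a[of "min a b"] b[of "max a b"]
    by (intro IVT) (auto simp: std_normal_cdf_isCont)
  then have "u \<in> range std_normal_cdf" by auto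
  then show ?thesis unfolding std_normal_quantile_def by (rule f_inv_into_f)
qed

lemma std_normal_quantile_le_0:
  assumes "0 < u" "u \<le> 1 / 2"
  shows "std_normal_quantile u \<le> 0"
  using std_normal_cdf_strict_mono[of 0 "std_normal_quantile u"] std_normal_cdf_quantile[of u] assms
  by (fastforce simp: std_normal_cdf_0)

lemma std_normal_quantile_half: "std_normal_quantile (1 / 2) = 0"
  using std_normal_cdf_strict_mono[of "std_normal_quantile (1 / 2)" 0]
    std_normal_cdf_quantile[of "1 / 2"] std_normal_quantile_le_0[of "1 / 2"]
  by (force simp: std_normal_cdf_0)

section \<open>The one-dimensional integral behind the diagonal of the copula\<close>

text \<open>For independent standard normal X and Y this is the probability that X <= h and Y <= a
  X. It makes sense at \<open>a = 0\<close> too, which is the case of correlation 1.\<close>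

definition diag_integral :: "real \<Rightarrow> real \<Rightarrow> real" where
  "diag_integral a h = (LINT x:{..h}|std_normal_distribution. std_normal_cdf (a * x))"

text \<open>A bounded function is integrable for a probability measure, so the Bochner integral can
  be traded for a nonnegative one, to which Tonelli applies.\<close>

lemma ennreal_set_integral_std_normal:
  assumes [measurable]: "f \<in> borel_measurable borel" and f: "\<And>x. 0 \<le> f x" "\<And>x. f x \<le> 1"
  shows "ennreal (LINT x:{..h}|std_normal_distribution. f x) =
    (\<integral>\<^sup>+x\<in>{..h}. ennreal (std_normal_density x) * ennreal (f x) \<partial>lborel)"
proof -
  have "integrable std_normal_distribution (\<lambda>x. indicat_real {..h} x * f x)"
    by (rule std_normal.integrable_const_bound[where B = 1]) (auto simp: f indicator_def)
  then have "ennreal (LINT x:{..h}|std_normal_distribution. f x) =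
      (\<integral>\<^sup>+x. ennreal (indicat_real {..h} x * f x) \<partial>std_normal_distribution)"
    unfolding set_lebesgue_integral_def by (simp add: nn_integral_eq_integral f)
  also have "\<dots> = (\<integral>\<^sup>+x\<in>{..h}. ennreal (std_normal_density x) * ennreal (f x) \<partial>lborel)"
    by (subst nn_integral_density) (auto intro!: nn_integral_cong simp: indicator_def)
  finally show ?thesis .
qed

lemma diag_integral_nonneg: "0 \<le> diag_integral a h"
  unfolding diag_integral_def set_lebesgue_integral_def by simp

lemma ennreal_diag_integral:
  "ennreal (diag_integral a h) =
    (\<integral>\<^sup>+x\<in>{..h}. ennreal (std_normal_density x) * ennreal (std_normal_cdf (a * x)) \<partial>lborel)"
  unfolding diag_integral_def by (intro ennreal_set_integral_std_normal) auto

lemma set_integral_std_normal_const: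
  "(LINT x:{..h}|std_normal_distribution. c) = std_normal_cdf h * c"
  by (simp add: set_lebesgue_integral_def std_normal_cdf_def cdf_def)

lemma set_integral_std_normal_le:
  assumes [measurable]: "f \<in> borel_measurable borel"
    and f: "\<And>x. 0 \<le> f x" "\<And>x. x \<le> h \<Longrightarrow> f x \<le> c" "0 \<le> c"
  shows "(LINT x:{..h}|std_normal_distribution. f x) \<le> std_normal_cdf h * c"
proof -
  have "(LINT x:{..h}|std_normal_distribution. f x) \<le> (LINT x:{..h}|std_normal_distribution. c)"
    unfolding set_lebesgue_integral_def
    using f by (intro integral_mono_AE' std_normal.integrable_const_bound[where B = c])
      (auto simp: indicator_def)
  then show ?thesis by (simp add: set_integral_std_normal_const)
qed

text \<open>On the range of integration \<open>a * x\<close> is at most \<open>a * h\<close>; this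
  becomes (U).\<close>

lemma diag_integral_le: "0 \<le> a \<Longrightarrow> diag_integral a h \<le> std_normal_cdf h * std_normal_cdf (a * h)"
  unfolding diag_integral_def
  by (intro set_integral_std_normal_le) (auto intro: std_normal_cdf_mono mult_left_mono)

lemma diag_integral_0: "diag_integral 0 h = std_normal_cdf h / 2"
  by (simp add: diag_integral_def set_integral_std_normal_const std_normal_cdf_0)

text \<open>Dominated convergence with the constant bound 1. Continuity at 0 is what reaches
  correlation 1.\<close>

lemma diag_integral_isCont: "isCont (\<lambda>a. diag_integral a h) a"
proof (rule continuous_at_sequentiallyI)
  fix u assume u: "u \<longlonglongrightarrow> a"
  show "(\<lambda>n. diag_integral (u n) h) \<longlonglongrightarrow> diag_integral a h"
    unfolding diag_integral_def set_lebesgue_integral_def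
  proof (rule integral_dominated_convergence[where w = "\<lambda>_. 1"])
    show "AE x in std_normal_distribution.
        (\<lambda>n. indicat_real {..h} x *\<^sub>R std_normal_cdf (u n * x))
          \<longlonglongrightarrow> indicat_real {..h} x *\<^sub>R std_normal_cdf (a * x)"
      using u by (intro AE_I2 tendsto_scaleR tendsto_const isCont_tendsto_compose[OF std_normal_cdf_isCont]
          tendsto_mult_right)
  qed (auto simp: indicator_def)
qed

section \<open>Comparison with the product of the marginals\<close>

text \<open>\<open>normal_density 0 (1 / a)\<close> is the density of Y / a for a standard normal Y,
  with mass \<open>std_normal_cdf (a * h)\<close> on \<open>{..h}\<close>. The product is thus an
  integral over a square, which is then folded.\<close>

lemma ennreal_cdf_product:
  assumes "0 < a"
  shows "ennreal (std_normal_cdf h * std_normal_cdf (a * h)) =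
    (\<integral>\<^sup>+x\<in>{..h}. (\<integral>\<^sup>+y\<in>{..x}.
       (ennreal (std_normal_density x * normal_density 0 (1 / a) y) +
        ennreal (std_normal_density y * normal_density 0 (1 / a) x)) \<partial>lborel) \<partial>lborel)"
proof -
  have "ennreal (std_normal_cdf h * std_normal_cdf (a * h)) =
      (\<integral>\<^sup>+x\<in>{..h}. ennreal (std_normal_density x) * ennreal (std_normal_cdf (a * h)) \<partial>lborel)"
    unfolding ennreal_mult[OF std_normal_cdf_nonneg std_normal_cdf_nonneg] ennreal_std_normal_cdf[of h]
    by (subst nn_integral_multc[symmetric]) (simp_all add: mult.assoc mult.commute[of "indicator _ _"])
  also have "\<dots> = (\<integral>\<^sup>+x\<in>{..h}. (\<integral>\<^sup>+y\<in>{..h}.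
      ennreal (std_normal_density x * normal_density 0 (1 / a) y) \<partial>lborel) \<partial>lborel)"
    using nn_integral_normal_density_atMost[of "1 / a" 0 h] assms
    by (simp add: ennreal_mult mult.assoc nn_integral_cmult mult.commute[of h])
  finally show ?thesis
    by (simp add: nn_integral_symmetrize_lborel)
qed

text \<open>Written over the same triangle as the folded product, so that the two integrands can be
  compared pointwise.\<close>

lemma ennreal_double_diag_integral:
  assumes "0 < a"
  shows "ennreal (2 * diag_integral a h) =
    (\<integral>\<^sup>+x\<in>{..h}. (\<integral>\<^sup>+y\<in>{..x}.
       2 * ennreal (std_normal_density x * normal_density 0 (1 / a) y) \<partial>lborel) \<partial>lborel)"
proof -
  have "(\<integral>\<^sup>+y\<in>{..x}. 2 * ennreal (std_normal_density x * normal_density 0 (1 / a) y) \<partial>lborel) =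
      2 * (ennreal (std_normal_density x) * ennreal (std_normal_cdf (a * x)))" for x
    using nn_integral_normal_density_atMost[of "1 / a" 0 x] assms
    by (simp add: ennreal_mult mult.assoc nn_integral_cmult mult.commute[of x])
  then show ?thesis
    by (simp add: ennreal_mult diag_integral_nonneg ennreal_diag_integral mult.assoc nn_integral_cmult)
qed

text \<open>For \<open>a = 1\<close> the two integrands over the triangle coincide. This yields
  equality in (L) at correlation 0.\<close>

lemma diag_integral_1: "2 * diag_integral 1 h = std_normal_cdf h * std_normal_cdf h"
proof -
  have "ennreal (2 * diag_integral 1 h) = ennreal (std_normal_cdf h * std_normal_cdf (1 * h))"
    unfolding ennreal_cdf_product[OF zero_less_one] ennreal_double_diag_integral[OF zero_less_one]
    by (simp add: mult.commute mult_2)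
  then show ?thesis
    by (simp add: diag_integral_nonneg)
qed

text \<open>The normalizing constants agree, and the exponents differ by half of
  \<open>(1 - a\<^sup>2) * (y\<^sup>2 - x\<^sup>2)\<close>, which is nonnegative because y lies
  further from 0 than x.\<close>

lemma normal_density_product_le:
  assumes "0 < a" "a \<le> 1" "y \<le> x" "x \<le> 0"
  shows "std_normal_density y * normal_density 0 (1 / a) x \<le> std_normal_density x * normal_density 0 (1 / a) y"
proof -
  have "0 \<le> (1 - a\<^sup>2) * (y\<^sup>2 - x\<^sup>2)"
    using assms by (intro mult_nonneg_nonneg) (auto simp: power_le_one abs_le_square_iff[symmetric])
  then have "exp (- y\<^sup>2 / 2 + - (x\<^sup>2 * a\<^sup>2) / 2) \<le> exp (- x\<^sup>2 / 2 + - (y\<^sup>2 * a\<^sup>2) / 2)"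
    by (simp add: algebra_simps)
  then have "exp (- y\<^sup>2 / 2) * exp (- (x\<^sup>2 * a\<^sup>2) / 2) \<le> exp (- x\<^sup>2 / 2) * exp (- (y\<^sup>2 * a\<^sup>2) / 2)"
    by (simp only: exp_add)
  then show ?thesis
    using assms by (simp add: normal_density_def power_divide divide_right_mono mult.assoc)
qed

text \<open>Since \<open>h \<le> 0\<close>, the whole triangle lies where the pointwise comparison
  of densities holds. The scale \<open>1 / a\<close> forces \<open>a\<close> to be positive.\<close>

lemma diag_integral_ge:
  assumes "0 < a" "a \<le> 1" "h \<le> 0"
  shows "std_normal_cdf h * std_normal_cdf (a * h) \<le> 2 * diag_integral a h"
proof -
  have "ennreal (std_normal_cdf h * std_normal_cdf (a * h)) \<le> ennreal (2 * diag_integral a h)"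
    unfolding ennreal_cdf_product[OF assms(1)] ennreal_double_diag_integral[OF assms(1)]
  proof (intro nn_integral_mono)
    fix x
    have "(\<integral>\<^sup>+y\<in>{..x}. (ennreal (std_normal_density x * normal_density 0 (1 / a) y) +
        ennreal (std_normal_density y * normal_density 0 (1 / a) x)) \<partial>lborel) \<le>
      (\<integral>\<^sup>+y\<in>{..x}. 2 * ennreal (std_normal_density x * normal_density 0 (1 / a) y) \<partial>lborel)"
      if "x \<le> h"
      using assms that
      by (intro nn_integral_mono)
         (auto simp: indicator_def mult_2 intro!: ennreal_leI normal_density_product_le)
    then show "(\<integral>\<^sup>+y\<in>{..x}. (ennreal (std_normal_density x * normal_density 0 (1 / a) y) +
        ennreal (std_normal_density y * normal_density 0 (1 / a) x)) \<partial>lborel) * indicator {..h} x \<le>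
      (\<integral>\<^sup>+y\<in>{..x}. 2 * ennreal (std_normal_density x * normal_density 0 (1 / a) y) \<partial>lborel) *
        indicator {..h} x"
      by (simp add: indicator_def)
  qed
  then show ?thesis
    by (simp add: diag_integral_nonneg)
qed

section \<open>The bivariate normal distribution function\<close>

text \<open>Completing the square in \<open>y\<close>: given x, the second coordinate is normal with
  mean \<open>\<rho> * x\<close> and variance \<open>1 - \<rho>\<^sup>2\<close>.\<close>

lemma bvn_density_eq:
  assumes "\<bar>\<rho>\<bar> < 1"
  shows "bvn_density \<rho> x y = std_normal_density x * normal_density (\<rho> * x) (sqrt (1 - \<rho>\<^sup>2)) y"
proof -
  define d where "d = 1 - \<rho>\<^sup>2"
  have d: "0 < d" using assms by (simp add: d_def abs_square_less_1)
  have "- ((x\<^sup>2 - 2 * \<rho> * x * y + y\<^sup>2) / (2 * d)) = - x\<^sup>2 / 2 + - (y - \<rho> * x)\<^sup>2 / (2 * d)"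
    using d by (simp add: field_simps) (simp add: d_def power2_eq_square algebra_simps)
  then have "exp (- ((x\<^sup>2 - 2 * \<rho> * x * y + y\<^sup>2) / (2 * d))) =
      exp (- x\<^sup>2 / 2) * exp (- (y - \<rho> * x)\<^sup>2 / (2 * d))"
    by (simp only: exp_add)
  moreover have "2 * pi * sqrt d = sqrt (2 * pi) * sqrt (2 * pi * d)"
    using d by (simp add: real_sqrt_mult ac_simps)
  ultimately show ?thesis
    using d unfolding bvn_density_def normal_density_def d_def[symmetric] by simp
qed

text \<open>The inner integral is the conditional distribution function of the second coordinate at
  \<open>k\<close>.\<close>

lemma bvn_cdf_eq:
  assumes "\<bar>\<rho>\<bar> < 1"
  shows "bvn_cdf \<rho> h k = (LINT x:{..h}|std_normal_distribution. std_normal_cdf ((k - \<rho> * x) / sqrt (1 - \<rho>\<^sup>2)))"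
proof -
  define s where "s = sqrt (1 - \<rho>\<^sup>2)"
  have s: "0 < s" using assms by (simp add: s_def abs_square_less_1)
  have "(LBINT y:{..k}. bvn_density \<rho> x y) = std_normal_density x * std_normal_cdf ((k - \<rho> * x) / s)" for x
  proof -
    have "(LBINT y:{..k}. normal_density (\<rho> * x) s y) =
        enn2real (\<integral>\<^sup>+y. ennreal (indicat_real {..k} y * normal_density (\<rho> * x) s y) \<partial>lborel)"
      unfolding set_lebesgue_integral_def by (subst integral_eq_nn_integral) auto
    also have "(\<integral>\<^sup>+y. ennreal (indicat_real {..k} y * normal_density (\<rho> * x) s y) \<partial>lborel) =
        (\<integral>\<^sup>+y\<in>{..k}. ennreal (normal_density (\<rho> * x) s y) \<partial>lborel)"
      by (intro nn_integral_cong) (simp add: indicator_def)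
    finally show ?thesis
      using s by (simp add: bvn_density_eq[OF assms] s_def[symmetric] nn_integral_normal_density_atMost)
  qed
  then show ?thesis
    unfolding bvn_cdf_def s_def[symmetric] set_lebesgue_integral_def
    by (subst integral_density) (auto simp: ac_simps)
qed

text \<open>By symmetry of the density the square counts as twice the triangle
  \<open>y \<le> x \<le> h\<close>, and there the conditional distribution function is evaluated at
  \<open>k = x\<close>, where its argument is linear in \<open>x\<close>.\<close>

lemma bvn_cdf_diag:
  assumes "\<bar>\<rho>\<bar> < 1"
  shows "bvn_cdf \<rho> h h = 2 * diag_integral (sqrt ((1 - \<rho>) / (1 + \<rho>))) h"
proof -
  define s where "s = sqrt (1 - \<rho>\<^sup>2)"
  have s: "0 < s" using assms by (simp add: s_def abs_square_less_1)
  define f where "f = (\<lambda>x y. ennreal (std_normal_density x * normal_density (\<rho> * x) s y))"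
  have [measurable]: "case_prod f \<in> borel_measurable (lborel \<Otimes>\<^sub>M lborel)"
    unfolding f_def normal_density_def by measurable
  \<comment> \<open>Symmetry is hidden in the conditional form of the density and visible in the
    original one.\<close>
  have sym: "f x y = f y x" for x y
    using bvn_density_eq[OF assms, of x y] bvn_density_eq[OF assms, of y x]
    by (simp add: f_def s_def bvn_density_def algebra_simps)
  have slice: "(\<integral>\<^sup>+y\<in>{..k}. f x y \<partial>lborel) =
      ennreal (std_normal_density x) * ennreal (std_normal_cdf ((k - \<rho> * x) / s))" for x k
    using nn_integral_normal_density_atMost[OF s, of "\<rho> * x" k]
    by (simp add: f_def ennreal_mult mult.assoc nn_integral_cmult)
  \<comment> \<open>This is the slope in the definition of \<open>bvn_g_interior\<close>.\<close>
  have "(1 - \<rho>) / s = sqrt ((1 - \<rho>) / (1 + \<rho>))"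
  proof -
    have "s = sqrt (1 - \<rho>) * sqrt (1 + \<rho>)"
      by (simp add: s_def real_sqrt_mult[symmetric] power2_eq_square algebra_simps)
    then show ?thesis
      using assms by (simp add: real_sqrt_divide real_div_sqrt flip: divide_divide_eq_left)
  qed
  then have a: "(x - \<rho> * x) / s = sqrt ((1 - \<rho>) / (1 + \<rho>)) * x" for x
    by (metis left_diff_distrib mult_1 times_divide_eq_left)
  have "ennreal (bvn_cdf \<rho> h h) = (\<integral>\<^sup>+x\<in>{..h}. (\<integral>\<^sup>+y\<in>{..h}. f x y \<partial>lborel) \<partial>lborel)"
    by (simp add: bvn_cdf_eq[OF assms] s_def[symmetric] slice ennreal_set_integral_std_normal)
  also have "\<dots> = (\<integral>\<^sup>+x\<in>{..h}. (\<integral>\<^sup>+y\<in>{..x}. 2 * f x y \<partial>lborel) \<partial>lborel)"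
    by (simp add: nn_integral_symmetrize_lborel sym[of y for y] mult_2)
  also have "\<dots> = ennreal (2 * diag_integral (sqrt ((1 - \<rho>) / (1 + \<rho>))) h)"
    by (simp add: mult.assoc nn_integral_cmult slice a ennreal_mult diag_integral_nonneg ennreal_diag_integral)
  finally show ?thesis
    by (subst (asm) ennreal_inj)
       (simp_all add: diag_integral_nonneg bvn_cdf_eq[OF assms] set_lebesgue_integral_def)
qed

lemma bvn_cdf_nonneg: "\<bar>\<rho>\<bar> < 1 \<Longrightarrow> 0 \<le> bvn_cdf \<rho> h k"
  by (simp add: bvn_cdf_eq set_lebesgue_integral_def)

lemma bvn_cdf_le_left: "\<bar>\<rho>\<bar> < 1 \<Longrightarrow> bvn_cdf \<rho> h k \<le> std_normal_cdf h"
  using set_integral_std_normal_le[of "\<lambda>x. std_normal_cdf ((k - \<rho> * x) / sqrt (1 - \<rho>\<^sup>2))" h 1]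
  by (simp add: bvn_cdf_eq)

section \<open>The copula on the diagonal\<close>

text \<open>At the corner the copula is a limit from the open square, where its values are squeezed
  between 0 and the first coordinate.\<close>

lemma bvn_copula_nondegenerate_0:
  assumes "\<bar>\<rho>\<bar> < 1"
  shows "bvn_copula_nondegenerate \<rho> 0 0 = 0"
proof -
  let ?S = "{0<..<1} \<times> {0<..<1} :: (real \<times> real) set"
  have "((\<lambda>(x, y). bvn_copula_interior \<rho> x y) \<longlongrightarrow> 0) (at (0, 0) within ?S)"
  proof (rule tendsto_sandwich[OF _ _ tendsto_const])
    show "((\<lambda>z. fst z) \<longlongrightarrow> (0::real)) (at (0, 0::real) within ?S)"
      by (auto intro!: tendsto_eq_intros)
    show "\<forall>\<^sub>F z in at (0, 0) within ?S. 0 \<le> (case z of (x, y) \<Rightarrow> bvn_copula_interior \<rho> x y)"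
      using assms by (simp add: bvn_copula_interior_def bvn_cdf_nonneg case_prod_unfold)
    show "\<forall>\<^sub>F z in at (0, 0) within ?S. (case z of (x, y) \<Rightarrow> bvn_copula_interior \<rho> x y) \<le> fst z"
      unfolding eventually_at_filter
    proof (intro always_eventually allI impI)
      fix z :: "real \<times> real"
      assume "z \<in> ?S"
      then show "(case z of (x, y) \<Rightarrow> bvn_copula_interior \<rho> x y) \<le> fst z"
        using bvn_cdf_le_left[OF assms, of "std_normal_quantile (fst z)" "std_normal_quantile (snd z)"]
        by (auto simp: bvn_copula_interior_def std_normal_cdf_quantile)
    qed
  qed
  \<comment> \<open>\<open>Lim\<close> is determined by convergence only along a nontrivial
    filter.\<close>
  moreover have "at (0, 0) within ?S \<noteq> bot"
  proof -
    have "(0, 0) \<in> closure ?S"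
      by (simp add: closure_Times)
    then show ?thesis
      by (simp add: at_within_eq_bot_iff)
  qed
  ultimately show ?thesis
    unfolding bvn_copula_nondegenerate_def by (simp add: tendsto_Lim)
qed

lemma bvn_copula_0:
  assumes "0 \<le> \<rho>" "\<rho> \<le> 1"
  shows "bvn_copula \<rho> 0 0 = 0"
proof (cases "\<rho> = 1")
  case True
  have "\<forall>\<^sub>F r in at_left 1. bvn_copula_nondegenerate r 0 0 = 0"
    using eventually_at_left_real[of 0 "1::real"]
    by (auto elim!: eventually_mono intro!: bvn_copula_nondegenerate_0)
  then have "((\<lambda>r. bvn_copula_nondegenerate r 0 0) \<longlongrightarrow> 0) (at_left (1::real))"
    by (rule tendsto_eventually)
  then show ?thesis
    by (simp add: bvn_copula_def True tendsto_Lim)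
next
  case False
  then show ?thesis
    using assms by (simp add: bvn_copula_def bvn_copula_nondegenerate_0)
qed

text \<open>Below correlation 1 this is \<open>bvn_cdf_diag\<close>; at 1 the slope tends to 0 and
  continuity of \<open>diag_integral\<close> in its first argument identifies the limit.\<close>

lemma bvn_copula_diag:
  assumes "0 \<le> \<rho>" "\<rho> \<le> 1" "0 < u" "u < 1"
  shows "bvn_copula \<rho> u u = 2 * diag_integral (sqrt ((1 - \<rho>) / (1 + \<rho>))) (std_normal_quantile u)"
proof -
  let ?c = "\<lambda>r. 2 * diag_integral (sqrt ((1 - r) / (1 + r))) (std_normal_quantile u)"
  have nondeg: "bvn_copula_nondegenerate r u u = ?c r" if "0 \<le> r" "r < 1" for r
    using that assms by (simp add: bvn_copula_nondegenerate_def bvn_copula_interior_def bvn_cdf_diag)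
  show ?thesis
  proof (cases "\<rho> = 1")
    case True
    have "((\<lambda>r. sqrt ((1 - r) / (1 + r))) \<longlongrightarrow> 0) (at_left (1::real))"
      by (auto intro!: tendsto_eq_intros)
    then have "(?c \<longlongrightarrow> 2 * diag_integral 0 (std_normal_quantile u)) (at_left 1)"
      by (intro tendsto_mult_left isCont_tendsto_compose[OF diag_integral_isCont])
    moreover have "\<forall>\<^sub>F r in at_left 1. ?c r = bvn_copula_nondegenerate r u u"
      using eventually_at_left_real[of 0 "1::real"]
      by (auto elim!: eventually_mono simp: nondeg)
    ultimately have "((\<lambda>r. bvn_copula_nondegenerate r u u) \<longlongrightarrow> ?c 1) (at_left 1)"
      by (simp add: filterlim_cong)
    then show ?thesis
      by (simp add: bvn_copula_def True tendsto_Lim)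
  next
    case False
    then show ?thesis
      using assms by (simp add: bvn_copula_def nondeg)
  qed
qed

section \<open>The bounds, their tightness and the extremal errors\<close>

lemma bvn_copula_diag_bounds:
  assumes "0 \<le> \<rho>" "\<rho> \<le> 1" "0 \<le> u" "u \<le> 1 / 2"
  shows "u * bvn_g \<rho> u \<le> bvn_copula \<rho> u u"
    and "bvn_copula \<rho> u u \<le> 2 * u * bvn_g \<rho> u"
    and "u * bvn_g \<rho> u \<le> 1 / 4"
    and "\<rho> = 0 \<or> u = 0 \<Longrightarrow> bvn_copula \<rho> u u = u * bvn_g \<rho> u"
    and "\<rho> = 1 \<or> u = 0 \<Longrightarrow> bvn_copula \<rho> u u = 2 * u * bvn_g \<rho> u"
proof -
  define a where "a = sqrt ((1 - \<rho>) / (1 + \<rho>))"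
  define h where "h = std_normal_quantile u"
  have a: "0 \<le> a" "a \<le> 1" "a = 0 \<longleftrightarrow> \<rho> = 1" "\<rho> = 0 \<Longrightarrow> a = 1"
    using assms by (auto simp: a_def)
  have "u * bvn_g \<rho> u \<le> bvn_copula \<rho> u u \<and> bvn_copula \<rho> u u \<le> 2 * u * bvn_g \<rho> u \<and>
      u * bvn_g \<rho> u \<le> 1 / 4 \<and> (\<rho> = 0 \<or> u = 0 \<longrightarrow> bvn_copula \<rho> u u = u * bvn_g \<rho> u) \<and>
      (\<rho> = 1 \<or> u = 0 \<longrightarrow> bvn_copula \<rho> u u = 2 * u * bvn_g \<rho> u)"
  proof (cases "u = 0")
    \<comment> \<open>The copula vanishes at the corner, and the factor \<open>u\<close> makes the
      other side 0.\<close>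
    case True
    then show ?thesis
      using assms by (simp add: bvn_copula_0)
  next
    case False
    then have u: "0 < u" "u < 1"
      using assms by auto
    have h: "h \<le> 0" "std_normal_cdf h = u"
      using u assms by (auto simp: h_def std_normal_quantile_le_0 std_normal_cdf_quantile)
    have g: "bvn_g \<rho> u = std_normal_cdf (a * h)"
      using u by (simp add: bvn_g_def bvn_g_interior_def a_def h_def)
    have C: "bvn_copula \<rho> u u = 2 * diag_integral a h"
      using assms u by (simp add: bvn_copula_diag a_def h_def)
    have "std_normal_cdf (a * h) \<le> 1 / 2"
      using std_normal_cdf_mono[of "a * h" 0] a h by (simp add: std_normal_cdf_0 mult_nonneg_nonpos)
    then have "u * bvn_g \<rho> u \<le> 1 / 2 * (1 / 2)"
      using assms unfolding g by (intro mult_mono) auto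
    moreover have "u * bvn_g \<rho> u \<le> bvn_copula \<rho> u u"
    \<comment> \<open>At \<open>a = 0\<close> the copula equals \<open>u\<close> and the bound
      equals \<open>u / 2\<close>; \<open>diag_integral_ge\<close> covers positive
      \<open>a\<close>.\<close>
    proof (cases "a = 0")
      case True
      then show ?thesis
        using u by (simp add: C g h diag_integral_0 std_normal_cdf_0)
    next
      case False
      then show ?thesis
        using diag_integral_ge[of a h] a h by (simp add: C g)
    qed
    moreover have "\<rho> = 0 \<Longrightarrow> bvn_copula \<rho> u u = u * bvn_g \<rho> u"
      unfolding C g using a(4) diag_integral_1[of h] by (simp add: h)
    moreover have "\<rho> = 1 \<Longrightarrow> bvn_copula \<rho> u u = 2 * u * bvn_g \<rho> u"
      unfolding C g using a(3) by (simp add: h diag_integral_0 std_normal_cdf_0)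
    ultimately show ?thesis
      using diag_integral_le[OF a(1), of h] u by (simp add: C g h)
  qed
  then show "u * bvn_g \<rho> u \<le> bvn_copula \<rho> u u"
    and "bvn_copula \<rho> u u \<le> 2 * u * bvn_g \<rho> u"
    and "u * bvn_g \<rho> u \<le> 1 / 4"
    and "\<rho> = 0 \<or> u = 0 \<Longrightarrow> bvn_copula \<rho> u u = u * bvn_g \<rho> u"
    and "\<rho> = 1 \<or> u = 0 \<Longrightarrow> bvn_copula \<rho> u u = 2 * u * bvn_g \<rho> u"
    by auto
qed

text \<open>The quantile of 1/2 is 0, which absorbs the slope.\<close>

lemma bvn_g_half: "bvn_g \<rho> (1 / 2) = 1 / 2"
  by (simp add: bvn_g_def bvn_g_interior_def std_normal_quantile_half std_normal_cdf_0)

theorem theorem5p1: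
  shows
    "(\<forall>\<rho>\<in>{0..1}. \<forall>u\<in>{0..1/2}. bvn_copula \<rho> u u \<ge> u * bvn_g \<rho> u) \<and>
     (\<forall>\<rho>\<in>{0..1}. \<forall>u\<in>{0..1/2}. bvn_copula \<rho> u u \<le> 2 * u * bvn_g \<rho> u) \<and>
     (\<forall>\<rho>\<in>{0..1}. \<forall>u\<in>{0..1/2}. \<rho> = 0 \<or> u = 0 \<longrightarrow> bvn_copula \<rho> u u = u * bvn_g \<rho> u) \<and>
     is_arg_max (\<lambda>(\<rho>, u). bvn_copula \<rho> u u - u * bvn_g \<rho> u)
       (\<lambda>(\<rho>, u). \<rho> \<in> {0..1} \<and> u \<in> {0..1/2}) (1, 1/2) \<and>
     bvn_copula 1 (1/2) (1/2) - 1/2 * bvn_g 1 (1/2) = 1/4 \<and>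
     (\<forall>\<rho>\<in>{0..1}. \<forall>u\<in>{0..1/2}. \<rho> = 1 \<or> u = 0 \<longrightarrow> bvn_copula \<rho> u u = 2 * u * bvn_g \<rho> u) \<and>
     is_arg_max (\<lambda>(\<rho>, u). 2 * u * bvn_g \<rho> u - bvn_copula \<rho> u u)
       (\<lambda>(\<rho>, u). \<rho> \<in> {0..1} \<and> u \<in> {0..1/2}) (0, 1/2) \<and>
     2 * (1/2) * bvn_g 0 (1/2) - bvn_copula 0 (1/2) (1/2) = 1/4"
proof -
  \<comment> \<open>Equality in (U) holds here, so the error of (L) is exactly
    \<open>u * bvn_g \<rho> u\<close>, that is 1/4. The error of (U) at correlation 0 is found
    likewise from equality in (L).\<close>
  have L: "bvn_copula 1 (1/2) (1/2) - 1/2 * bvn_g 1 (1/2) = 1/4"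
    using bvn_copula_diag_bounds(5)[of 1 "1/2"] by (simp add: bvn_g_half)
  have U: "2 * (1/2) * bvn_g 0 (1/2) - bvn_copula 0 (1/2) (1/2) = 1/4"
    using bvn_copula_diag_bounds(4)[of 0 "1/2"] by (simp add: bvn_g_half)
  \<comment> \<open>With p for \<open>u * bvn_g \<rho> u\<close>, the copula lies between p and 2p,
    so either error is at most p, hence at most 1/4.\<close>
  have max: "bvn_copula \<rho> u u - u * bvn_g \<rho> u \<le> 1/4" "2 * u * bvn_g \<rho> u - bvn_copula \<rho> u u \<le> 1/4"
    if "0 \<le> \<rho>" "\<rho> \<le> 1" "0 \<le> u" "u \<le> 1/2" for \<rho> u
    using bvn_copula_diag_bounds(1-3)[OF that] by linarith+
  have "is_arg_max (\<lambda>(\<rho>, u). bvn_copula \<rho> u u - u * bvn_g \<rho> u)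
       (\<lambda>(\<rho>, u). \<rho> \<in> {0..1} \<and> u \<in> {0..1/2}) (1, 1/2)"
    and "is_arg_max (\<lambda>(\<rho>, u). 2 * u * bvn_g \<rho> u - bvn_copula \<rho> u u)
       (\<lambda>(\<rho>, u). \<rho> \<in> {0..1} \<and> u \<in> {0..1/2}) (0, 1/2)"
    unfolding is_arg_max_linorder split_paired_All prod.case L U using max by simp_all
  with L U show ?thesis
    using bvn_copula_diag_bounds by (simp del: times_divide_eq_left)
qed

end
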